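(* Let $G=(V,E)$ be a finite connected graph. Let $o\in V$, let $T_o$ be an $o$-spanning tree of $G$, and let $(V,\ast)$ be the travel groupoid on $G$ constructed from $(o,T_o)$ by the algorithm described in the context. Then $(V,\ast)$ is smooth.
   Context: Graphs have no multiple edges and no loops. A groupoid $(V,\ast)$ is a non-empty set $V$ with a binary operation $\ast:V\times V\to V$. A travel groupoid is a groupoid $(V,\ast)$ satisfying (t1) $(u\ast v)\ast u=u$ for all $u,v\in V$; (t2) for all $u,v\in V$, if $(u\ast v)\ast v=u$, then $u=v$. A travel groupoid $(V,\ast)$ is on a graph $G$ if $V(G)=V$ and $E(G)=\{\{u,v\} \mid u,v\in V \text{ and } u\neq u\ast v=v\}$. A travel groupoid $(V,\ast)$ is smooth if it satisfies (t4) for all $u,v,w\in V$, if $u\ast v=u\ast w$, then $u\ast(w\ast v)=u\ast v$. For a vertex $v$ of a graph $G$, a $v$-spanning tree of $G$ is a spanning tree of $G$ that contains all edges of $G$ incident to $v$. For a tree $T$ and distinct vertices $u,v$ of $T$, $A_T(u,v)$ denotes the unique vertex with $d(u,A_T(u,v))=1$ and $d(A_T(u,v),v)=d(u,v)-1$, where $d$ is the distance in $T$ (i.e. the vertex following $u$ on the unique $u$-$v$ path in $T$). Algorithm. Let $G=(V,E)$ be a finite connected graph. Step 1: Fix a vertex $o\in V$ and an $o$-spanning tree $T_o$ of $G$. Put $o\ast v=A_{T_o}(o,v)$ for every $v\in V$ with $v\ne o$, and $o\ast o=o$. Step 2: For every vertex $u\neq o$, construct a $u$-spanning tree $T_u$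 from $T_o$ as follows. Let $S(u)$ be the set of all edges of $G$ incident to $u$ and let $L(u)=(E\setminus E(T_o))\cap S(u)$. Start with $T=T_o$. For each edge $e=\{u,x\}\in L(u)$, one after another, replace the current tree $T$ as follows: $T\cup\{e\}$ contains a unique cycle; remove from $T\cup\{e\}$ the edge of this cycle other than $e$ that is incident to $x$ (the endpoint of $e$ other than $u$), and take the resulting tree as the new $T$. After all edges of $L(u)$ have been processed, the resulting tree is $T_u$. (It is a $u$-spanning tree of $G$, and it does not depend on the order in which the edges of $L(u)$ are processed.) Step 3: For every $u\neq o$, put $u\ast v=A_{T_u}(u,v)$ for every $v\in V$ with $v\neq u$, and $u\ast u=u$. *)

theory Defs
  imports Main
begin

section \<open>Finite simple graphs\<close>

text \<open>
  A graph is given by its vertex set and its set of edges, an edge being an unordered pair of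
  distinct vertices.  The session Graph_Theory is not used: it treats undirected graphs as
  symmetric digraphs, and there every edge already yields a closed walk of length two that counts
  as a cycle, so its trees are not the undirected ones.
\<close>

definition simple_graph :: "'a set \<Rightarrow> 'a set set \<Rightarrow> bool" where
  "simple_graph V E \<longleftrightarrow> (\<forall>e\<in>E. \<exists>u\<in>V. \<exists>v\<in>V. u \<noteq> v \<and> e = {u, v})"

definition walk :: "'a set \<Rightarrow> 'a set set \<Rightarrow> 'a \<Rightarrow> 'a list \<Rightarrow> 'a \<Rightarrow> bool" where
  "walk V E u p v \<longleftrightarrow> p \<noteq> [] \<and> hd p = u \<and> last p = v \<and> set p \<subseteq> V \<and>
     successively (\<lambda>x y. {x, y} \<in> E) p"

definition connected_graph :: "'a set \<Rightarrow> 'a set set \<Rightarrow> bool" where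
  "connected_graph V E \<longleftrightarrow> V \<noteq> {} \<and> (\<forall>u\<in>V. \<forall>v\<in>V. \<exists>p. walk V E u p v)"

text \<open>
  A cycle is the list of its vertices in cyclic order; the first vertex is not repeated at the end.
\<close>

definition cycle_edges :: "'a list \<Rightarrow> 'a set set" where
  "cycle_edges c = {{c ! i, c ! (Suc i mod length c)} | i. i < length c}"

definition is_cycle :: "'a set set \<Rightarrow> 'a list \<Rightarrow> bool" where
  "is_cycle E c \<longleftrightarrow> 3 \<le> length c \<and> distinct c \<and> cycle_edges c \<subseteq> E"

definition is_tree :: "'a set \<Rightarrow> 'a set set \<Rightarrow> bool" where
  "is_tree V T \<longleftrightarrow> simple_graph V T \<and> connected_graph V T \<and> (\<nexists>c. is_cycle T c)"

text \<open>A spanning tree has the same vertex set as the graph, so it is given by its edges.\<close>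

definition spanning_tree :: "'a set \<Rightarrow> 'a set set \<Rightarrow> 'a set set \<Rightarrow> bool" where
  "spanning_tree V E T \<longleftrightarrow> T \<subseteq> E \<and> is_tree V T"

definition incident_edges :: "'a set set \<Rightarrow> 'a \<Rightarrow> 'a set set" where
  "incident_edges E v = {e \<in> E. v \<in> e}"

definition vertex_spanning_tree :: "'a set \<Rightarrow> 'a set set \<Rightarrow> 'a \<Rightarrow> 'a set set \<Rightarrow> bool" where
  "vertex_spanning_tree V E v T \<longleftrightarrow> spanning_tree V E T \<and> incident_edges E v \<subseteq> T"

text \<open>The distance is only meaningful for vertices joined by a walk.\<close>

definition graph_dist :: "'a set \<Rightarrow> 'a set set \<Rightarrow> 'a \<Rightarrow> 'a \<Rightarrow> nat" where
  "graph_dist V E u v = (LEAST n. \<exists>p. walk V E u p v \<and> length p = Suc n)"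

text \<open>\<open>next_vertex V T u v\<close> is $A_T(u,v)$; it is only meaningful for a tree and \<open>u \<noteq> v\<close>.\<close>

definition next_vertex :: "'a set \<Rightarrow> 'a set set \<Rightarrow> 'a \<Rightarrow> 'a \<Rightarrow> 'a" where
  "next_vertex V T u v =
     (THE w. w \<in> V \<and> graph_dist V T u w = 1 \<and> graph_dist V T w v = graph_dist V T u v - 1)"


section \<open>Travel groupoids\<close>

definition groupoid :: "'a set \<Rightarrow> ('a \<Rightarrow> 'a \<Rightarrow> 'a) \<Rightarrow> bool" where
  "groupoid V f \<longleftrightarrow> V \<noteq> {} \<and> (\<forall>u\<in>V. \<forall>v\<in>V. f u v \<in> V)"

definition travel_groupoid :: "'a set \<Rightarrow> ('a \<Rightarrow> 'a \<Rightarrow> 'a) \<Rightarrow> bool" where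
  "travel_groupoid V f \<longleftrightarrow> groupoid V f \<and>
     (\<forall>u\<in>V. \<forall>v\<in>V. f (f u v) u = u) \<and>
     (\<forall>u\<in>V. \<forall>v\<in>V. f (f u v) v = u \<longrightarrow> u = v)"

definition travel_groupoid_on ::
    "'a set \<Rightarrow> 'a set set \<Rightarrow> ('a \<Rightarrow> 'a \<Rightarrow> 'a) \<Rightarrow> bool" where
  "travel_groupoid_on V E f \<longleftrightarrow> travel_groupoid V f \<and>
     E = {{u, v} | u v. u \<in> V \<and> v \<in> V \<and> u \<noteq> f u v \<and> f u v = v}"

definition smooth_travel_groupoid :: "'a set \<Rightarrow> ('a \<Rightarrow> 'a \<Rightarrow> 'a) \<Rightarrow> bool" where
  "smooth_travel_groupoid V f \<longleftrightarrow> travel_groupoid V f \<and>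
     (\<forall>u\<in>V. \<forall>v\<in>V. \<forall>w\<in>V. f u v = f u w \<longrightarrow> f u (f w v) = f u v)"


section \<open>The algorithm\<close>

text \<open>
  \<open>exchange u x T T'\<close>: the tree \<open>T'\<close> arises from \<open>T\<close> by adding the edge $e = \{u,x\}$ and removing,
  from the cycle this creates, the edge at \<open>x\<close> other than \<open>e\<close>.
\<close>

definition exchange :: "'a \<Rightarrow> 'a \<Rightarrow> 'a set set \<Rightarrow> 'a set set \<Rightarrow> bool" where
  "exchange u x T T' \<longleftrightarrow> (\<exists>c g. is_cycle (insert {u, x} T) c \<and>
     g \<in> cycle_edges c \<and> g \<noteq> {u, x} \<and> x \<in> g \<and> T' = insert {u, x} T - {g})"

text \<open>
  \<open>exchanges u L T T'\<close>: the tree \<open>T'\<close> arises from \<open>T\<close> by processing all the edges of \<open>L\<close>, each of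
  them once, in some order.
\<close>

inductive exchanges :: "'a \<Rightarrow> 'a set set \<Rightarrow> 'a set set \<Rightarrow> 'a set set \<Rightarrow> bool" for u where
  exchanges_done: "exchanges u {} T T"
| exchanges_step: "{u, x} \<in> L \<Longrightarrow> exchange u x T T' \<Longrightarrow> exchanges u (L - {{u, x}}) T' T'' \<Longrightarrow>
    exchanges u L T T''"

text \<open>
  \<open>f\<close> is an outcome of the algorithm for the vertex \<open>r\<close> (called $o$ in the literature) and the
  tree \<open>T0\<close>.  As a relation this covers every order in which the edges may be processed.
\<close>

definition algorithm_output ::
    "'a set \<Rightarrow> 'a set set \<Rightarrow> 'a \<Rightarrow> 'a set set \<Rightarrow> ('a \<Rightarrow> 'a \<Rightarrow> 'a) \<Rightarrow> bool" where
  "algorithm_output V E r T0 f \<longleftrightarrow> (\<exists>T.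
     T r = T0 \<and>
     (\<forall>u\<in>V - {r}. exchanges u ((E - T0) \<inter> incident_edges E u) T0 (T u)) \<and>
     (\<forall>u\<in>V. f u u = u \<and> (\<forall>v\<in>V - {u}. f u v = next_vertex V (T u) u v)))"

end

theory Submission
  imports Defs
begin

text \<open>
  Fix a vertex \<open>u\<close> and root the tree \<open>T0\<close> at \<open>u\<close>; let \<open>n z\<close> be the vertex that
  follows \<open>z\<close> on the tree path from \<open>z\<close> to \<open>u\<close>.  One exchange for an edge \<open>{u, x}\<close>
  merely redirects the parent pointer of \<open>x\<close> from \<open>n x\<close> to \<open>u\<close>: the vertex \<open>x\<close> is the
  deepest one on the cycle, so the other cycle edge at \<open>x\<close> is the one that leads to its parent
  (lemma \<open>cycle_edge_removed_by_exchange\<close>).  Hence in the final tree for \<open>u\<close> the parent of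
  \<open>z\<close> is \<open>u\<close> if \<open>z\<close> is a neighbour of \<open>u\<close> in the graph, and \<open>n z\<close> otherwise.  The order
  of the exchanges is irrelevant, and the operation has the following description in terms of
  \<open>T0\<close> alone (lemma \<open>algorithm_output_recursion\<close>):

  \<^item> for \<open>v \<noteq> u\<close>, \<open>f u v\<close> is the first vertex adjacent to \<open>u\<close> in the graph on the \<open>T0\<close>-path
    from \<open>v\<close> to \<open>u\<close>.

  That \<open>f\<close> is on the graph, and the axiom (t1), can be read off from this.  The other two axioms
  rest on two connectivity facts about \<open>T0\<close>.  First, for \<open>x = f u v\<close> the fibre
  \<open>{z. z \<noteq> u \<and> f u z = x}\<close> contains, with each of its vertices, the \<open>T0\<close>-path from there to
  \<open>x\<close>, so it is connected in \<open>T0\<close> (lemma \<open>first_neighbour_fibre\<close>).  Second, \<open>f w v\<close> lies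
  on the \<open>T0\<close>-path from \<open>v\<close> to \<open>w\<close>, so every \<open>T0\<close>-connected set that contains \<open>v\<close>
  and \<open>w\<close> contains \<open>f w v\<close> (lemma \<open>step_in_connected_set\<close>).  Together they say that the
  fibres of \<open>f u\<close> are closed under \<open>f\<close>.  This is smoothness, and it gives (t2) as well:
  \<open>v\<close> and \<open>f u v\<close> lie in the same fibre, hence so does \<open>f (f u v) v\<close>, which is therefore
  different from \<open>u\<close>.
\<close>


section \<open>Walks as powers of the adjacency relation\<close>

text \<open>
  The edges are cut down to \<open>V\<close> so that connectedness inside a set \<open>S\<close> of vertices of a tree
  \<open>T\<close> can be expressed as reachability in \<open>arcs S T\<close>.
\<close>

definition arcs :: "'a set \<Rightarrow> 'a set set \<Rightarrow> ('a \<times> 'a) set" where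
  "arcs V T = {(x, y). x \<in> V \<and> y \<in> V \<and> {x, y} \<in> T}"

lemma sym_arcs: "sym (arcs V T)"
  by (auto simp: arcs_def sym_def insert_commute)

lemma rtrancl_arcs_sym: "(x, y) \<in> (arcs V T)\<^sup>* \<Longrightarrow> (y, x) \<in> (arcs V T)\<^sup>*"
  using sym_rtrancl[OF sym_arcs] by (meson symD)

lemma walk_Cons:
  assumes "q \<noteq> []"
  shows "walk V T u (a # q) v \<longleftrightarrow> a = u \<and> (u, hd q) \<in> arcs V T \<and> walk V T (hd q) q v"
  using assms by (cases q) (auto simp: walk_def arcs_def)

lemma ex_walk_iff_relpow:
  assumes "u \<in> V"
  shows "(\<exists>p. walk V T u p v \<and> length p = Suc k) \<longleftrightarrow> (u, v) \<in> arcs V T ^^ k"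
  using assms
proof (induction k arbitrary: u)
  case 0
  then show ?case
    by (auto simp: walk_def length_Suc_conv intro!: exI[of _ "[u]"])
next
  case (Suc k)
  show ?case
  proof
    assume "\<exists>p. walk V T u p v \<and> length p = Suc (Suc k)"
    then obtain a q where q: "walk V T u (a # q) v" "length q = Suc k"
      by (metis length_Suc_conv)
    then have "q \<noteq> []" by auto
    with q have "(u, hd q) \<in> arcs V T" "walk V T (hd q) q v"
      by (auto simp: walk_Cons)
    moreover from this have "(hd q, v) \<in> arcs V T ^^ k"
      using Suc.IH[of "hd q"] q(2) by (auto simp: arcs_def)
    ultimately show "(u, v) \<in> arcs V T ^^ Suc k"
      by (meson relpow_Suc_I2)
  next
    assume "(u, v) \<in> arcs V T ^^ Suc k"
    then obtain y where y: "(u, y) \<in> arcs V T" "(y, v) \<in> arcs V T ^^ k"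
      by (meson relpow_Suc_E2)
    then obtain q where q: "walk V T y q v" "length q = Suc k"
      using Suc.IH[of y] by (auto simp: arcs_def)
    then have "q \<noteq> []" "hd q = y" by (auto simp: walk_def)
    then have "walk V T u (u # q) v" using q y by (simp add: walk_Cons)
    then show "\<exists>p. walk V T u p v \<and> length p = Suc (Suc k)"
      using q(2) by force
  qed
qed

lemma graph_dist_eq_Least_relpow:
  assumes "u \<in> V"
  shows "graph_dist V T u v = (LEAST k. (u, v) \<in> arcs V T ^^ k)"
  unfolding graph_dist_def ex_walk_iff_relpow[OF assms] ..

lemma connected_graph_rtrancl_arcs:
  assumes "connected_graph V T" "u \<in> V" "v \<in> V"
  shows "(u, v) \<in> (arcs V T)\<^sup>*"
proof -
  obtain p where p: "walk V T u p v"
    using assms by (auto simp: connected_graph_def)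
  then obtain k where "length p = Suc k"
    by (cases p) (auto simp: walk_def)
  with p show ?thesis
    using ex_walk_iff_relpow[OF assms(2)] relpow_imp_rtrancl by metis
qed

text \<open>A shortest walk repeats no vertex, since the part between two visits could be cut out.\<close>

lemma ex_distinct_walk:
  assumes "(u, v) \<in> (arcs V T)\<^sup>*" "u \<in> V"
  shows "\<exists>p. walk V T u p v \<and> distinct p"
proof -
  have "\<exists>p. walk V T u p v"
    using assms ex_walk_iff_relpow rtrancl_imp_relpow by metis
  then obtain p where p: "walk V T u p v"
    and least: "\<And>q. walk V T u q v \<Longrightarrow> length p \<le> length q"
    using ex_has_least_nat[of "\<lambda>p. walk V T u p v" _ length] by metis
  have "distinct p"
  proof (rule ccontr)
    assume "\<not> distinct p"
    then obtain xs ys zs y where eq: "p = xs @ [y] @ ys @ [y] @ zs"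
      using not_distinct_decomp by blast
    have "walk V T u (xs @ [y] @ zs) v"
      using p unfolding eq walk_def
      by (cases xs; cases zs) (auto simp: successively_append_iff successively_Cons hd_append split: if_splits)
    from least[OF this] show False by (simp add: eq)
  qed
  with p show ?thesis by blast
qed

lemma distinct_walk_closes_to_cycle:
  assumes "walk V T a p b" "distinct p" "3 \<le> length p"
  shows "is_cycle (insert {a, b} T) p"
proof -
  have "{p ! i, p ! (Suc i mod length p)} \<in> insert {a, b} T" if "i < length p" for i
  proof (cases "Suc i < length p")
    case True
    then show ?thesis using assms(1)
      by (auto simp: walk_def successively_conv_nth)
  next
    case False
    then have "i = length p - 1" using that by simp
    then have "p ! i = b" "p ! (Suc i mod length p) = a"
      using assms(1) that by (auto simp: walk_def last_conv_nth hd_conv_nth)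
    then show ?thesis by (simp add: insert_commute)
  qed
  then show ?thesis using assms by (auto simp: is_cycle_def cycle_edges_def)
qed

section \<open>Rooted trees\<close>

text \<open>
  A tree with root \<open>u\<close>, given by parent pointers \<open>n\<close>.  The function \<open>d\<close> only certifies that
  the pointers lead to the root; it need not be the distance to \<open>u\<close>, and so it can stay the
  same when a pointer is redirected to \<open>u\<close>.
\<close>

definition rooted_tree ::
    "'a set \<Rightarrow> 'a \<Rightarrow> ('a \<Rightarrow> 'a) \<Rightarrow> ('a \<Rightarrow> nat) \<Rightarrow> 'a set set \<Rightarrow> bool" where
  "rooted_tree V u n d T \<longleftrightarrow> u \<in> V \<and> d u = 0 \<and> (\<forall>z\<in>V - {u}. n z \<in> V \<and> d (n z) < d z) \<and>
     T = {{z, n z} | z. z \<in> V - {u}}"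

lemma rooted_tree_edgeE:
  assumes "rooted_tree V u n d T" "{a, b} \<in> T"
  obtains "a \<in> V - {u}" "b = n a" | "b \<in> V - {u}" "a = n b"
  using assms by (auto simp: rooted_tree_def doubleton_eq_iff)

lemma rooted_tree_rtrancl_root:
  assumes "rooted_tree V u n d T" "z \<in> V"
  shows "(z, u) \<in> (arcs V T)\<^sup>*"
  using assms(2)
proof (induction "d z" arbitrary: z rule: less_induct)
  case less
  show ?case
  proof (cases "z = u")
    case False
    then have "(z, n z) \<in> arcs V T" "d (n z) < d z" "n z \<in> V"
      using assms(1) less.prems by (auto simp: rooted_tree_def arcs_def)
    with less.hyps[of "n z"] show ?thesis by (meson converse_rtrancl_into_rtrancl)
  qed simp
qed

text \<open>
  Let every vertex point to a neighbour nearer to \<open>u\<close>.  The pointer edges already connect the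
  graph, so any further edge of the tree would close a cycle with a path of pointer edges.
\<close>

lemma tree_rooted_anywhere:
  assumes tree: "is_tree V T" and "u \<in> V"
  shows "\<exists>n d. rooted_tree V u n d T"
proof -
  have conn: "(z, u) \<in> (arcs V T)\<^sup>*" if "z \<in> V" for z
    using tree that \<open>u \<in> V\<close> by (auto simp: is_tree_def intro: connected_graph_rtrancl_arcs)
  define d where "d z = (LEAST k. (z, u) \<in> arcs V T ^^ k)" for z
  have "\<exists>y. (z, y) \<in> arcs V T \<and> d y < d z" if "z \<in> V - {u}" for z
  proof -
    have "\<exists>k. (z, u) \<in> arcs V T ^^ k" using conn[of z] that rtrancl_imp_relpow by auto
    then have *: "(z, u) \<in> arcs V T ^^ d z" unfolding d_def by (rule LeastI_ex)
    then have "d z \<noteq> 0" using that by (cases "d z") auto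
    then obtain k where k: "d z = Suc k" by (cases "d z") auto
    with * obtain y where "(z, y) \<in> arcs V T" "(y, u) \<in> arcs V T ^^ k"
      by (metis relpow_Suc_E2)
    moreover from this have "d y \<le> k" unfolding d_def by (intro Least_le)
    ultimately show ?thesis using k by auto
  qed
  then obtain n where n: "\<And>z. z \<in> V - {u} \<Longrightarrow> (z, n z) \<in> arcs V T \<and> d (n z) < d z"
    by metis
  define T1 where "T1 = {{z, n z} | z. z \<in> V - {u}}"
  have "d u = 0" by (simp add: d_def Least_eq_0)
  with n \<open>u \<in> V\<close> have rooted: "rooted_tree V u n d T1"
    by (auto simp: rooted_tree_def T1_def arcs_def)
  have sub: "T1 \<subseteq> T" using n by (auto simp: T1_def arcs_def)
  moreover have "T \<subseteq> T1"
  proof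
    fix e assume "e \<in> T"
    then obtain a b where ab: "a \<in> V" "b \<in> V" "a \<noteq> b" "e = {a, b}"
      using tree by (auto simp: is_tree_def simple_graph_def)
    show "e \<in> T1"
    proof (rule ccontr)
      assume "e \<notin> T1"
      have "(a, b) \<in> (arcs V T1)\<^sup>*"
        using rooted_tree_rtrancl_root[OF rooted] ab rtrancl_arcs_sym rtrancl_trans by metis
      then obtain p where p: "walk V T1 a p b" "distinct p"
        using ex_distinct_walk ab(1) by metis
      have "length p \<noteq> 0" "length p \<noteq> 1" "length p \<noteq> 2"
        using p(1) ab \<open>e \<notin> T1\<close> by (auto simp: walk_def length_Suc_conv numeral_2_eq_2)
      then have "3 \<le> length p" by linarith
      then have "is_cycle (insert {a, b} T1) p"
        using p by (intro distinct_walk_closes_to_cycle)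
      then have "is_cycle T p"
        using sub \<open>e \<in> T\<close> ab(4) by (auto simp: is_cycle_def)
      with tree show False by (auto simp: is_tree_def)
    qed
  qed
  ultimately show ?thesis using rooted by auto
qed

section \<open>Exchanges redirect parent pointers\<close>

lemma cycle_two_neighbours:
  assumes "is_cycle T c" "z \<in> set c"
  obtains a b where "a \<in> set c" "b \<in> set c" "a \<noteq> b" "a \<noteq> z" "b \<noteq> z" "{z, a} \<in> T" "{z, b} \<in> T"
proof -
  let ?k = "length c"
  have k: "3 \<le> ?k" and dist: "distinct c" and sub: "cycle_edges c \<subseteq> T"
    using assms by (auto simp: is_cycle_def)
  obtain i where i: "i < ?k" "z = c ! i" using assms(2) by (auto simp: in_set_conv_nth)
  define j where "j = Suc i mod ?k"
  define l where "l = (if i = 0 then ?k - 1 else i - 1)"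
  have jl: "j < ?k" "l < ?k" "Suc l mod ?k = i"
    using i k by (auto simp: j_def l_def intro!: mod_less_divisor)
  have "j \<noteq> l" "j \<noteq> i" "l \<noteq> i"
    using i k by (auto simp: j_def l_def mod_Suc split: if_splits)
  moreover have "{c ! i, c ! j} \<in> T" using sub i(1) by (auto simp: cycle_edges_def j_def)
  moreover have "{c ! l, c ! i} \<in> T"
    using sub jl(2,3) unfolding cycle_edges_def by blast
  ultimately show thesis
    using that[of "c ! j" "c ! l"] jl i dist by (auto simp: nth_eq_iff_index_eq insert_commute)
qed

text \<open>
  A vertex \<open>z\<close> of the cycle at which \<open>d\<close> is maximal has two neighbours on the cycle, and only
  one of them can be its parent, while none can be its child.  So one of its two edges is the new
  one, which leaves \<open>z = x\<close> because \<open>d u = 0 < d x\<close>.  The remaining cycle edge at \<open>x\<close> then goes to its parent.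
\<close>

lemma cycle_edge_removed_by_exchange:
  assumes rooted: "rooted_tree V u n d T" and x: "x \<in> V - {u}"
    and cyc: "is_cycle (insert {u, x} T) c"
    and g: "g \<in> cycle_edges c" "g \<noteq> {u, x}" "x \<in> g"
  shows "g = {x, n x}"
proof -
  obtain i where i: "i < length c" "g = {c ! i, c ! (Suc i mod length c)}"
    using g(1) by (auto simp: cycle_edges_def)
  have gc: "g \<subseteq> set c" and gT: "g \<in> T"
    using i g cyc by (auto simp: is_cycle_def intro!: nth_mem mod_less_divisor)
  have "set c \<noteq> {}" using gc g(3) by auto
  then obtain z where z: "z \<in> set c" "\<And>y. y \<in> set c \<Longrightarrow> d y \<le> d z"
    using finite_set[of c] Max_in[of "d ` set c"] Max_ge[of "d ` set c"]
    by (metis (no_types, lifting) finite_imageI image_iff image_is_empty)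
  obtain a b where ab: "a \<in> set c" "b \<in> set c" "a \<noteq> b" "a \<noteq> z" "b \<noteq> z"
    "{z, a} \<in> insert {u, x} T" "{z, b} \<in> insert {u, x} T"
    using cycle_two_neighbours[OF cyc z(1)] by metis
  have up: "y = n w" if "{w, y} \<in> T" "d y \<le> d w" for w y
    using rooted_tree_edgeE[OF rooted that(1)]
  proof cases
    case 2
    then have "d w < d y" using rooted by (auto simp: rooted_tree_def)
    with that(2) show ?thesis by simp
  qed
  have "{z, a} = {u, x} \<or> {z, b} = {u, x}"
    using up[of z a] up[of z b] ab z(2) by auto
  then have "z = u \<or> z = x" by (auto simp: doubleton_eq_iff)
  moreover have "z \<noteq> u"
  proof
    assume "z = u"
    then have "d y = 0" if "y \<in> set c" for y
      using z(2)[OF that] rooted by (auto simp: rooted_tree_def)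
    then have "d x = 0" using gc g(3) by auto
    moreover have "d (n x) < d x" using rooted x by (simp add: rooted_tree_def)
    ultimately show False by simp
  qed
  ultimately have "z = x" by simp
  moreover obtain y where y: "g = {x, y}" using g(3) i(2) by auto
  ultimately show ?thesis using up[of x y] gT gc z(2) by auto
qed

lemma exchange_rooted_tree:
  assumes rooted: "rooted_tree V u n d T" and x: "x \<in> V - {u}" and ex: "exchange u x T T'"
  shows "rooted_tree V u (n(x := u)) d T'"
proof -
  obtain c g where cg: "is_cycle (insert {u, x} T) c" "g \<in> cycle_edges c" "g \<noteq> {u, x}" "x \<in> g"
    and T': "T' = insert {u, x} T - {g}"
    using ex by (auto simp: exchange_def)
  have g: "g = {x, n x}" using cycle_edge_removed_by_exchange[OF rooted x cg] .
  have nx: "n x \<noteq> u" using cg(3) g by auto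
  have dec: "\<And>z. z \<in> V - {u} \<Longrightarrow> n z \<in> V \<and> d (n z) < d z"
    and T: "T = {{z, n z} | z. z \<in> V - {u}}" and u: "u \<in> V" "d u = 0"
    using rooted by (auto simp: rooted_tree_def)
  have other: "{z, n z} \<noteq> {x, n x}" if "z \<in> V - {u}" "z \<noteq> x" for z
    using dec[OF that(1)] dec[OF x] that(2) by (auto simp: doubleton_eq_iff)
  have "T' = {{z, (n(x := u)) z} | z. z \<in> V - {u}}"
  proof (intro set_eqI iffI)
    fix e assume "e \<in> T'"
    then consider "e = {u, x}" | z where "e = {z, n z}" "z \<in> V - {u}" "z \<noteq> x"
      unfolding T' g T by blast
    then show "e \<in> {{z, (n(x := u)) z} | z. z \<in> V - {u}}"
    proof cases
      case 1
      then have "e = {x, (n(x := u)) x}" by auto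
      then show ?thesis using x by blast
    next
      case 2
      then have "e = {z, (n(x := u)) z}" by auto
      then show ?thesis using 2 by blast
    qed
  next
    fix e assume "e \<in> {{z, (n(x := u)) z} | z. z \<in> V - {u}}"
    then obtain z where z: "z \<in> V - {u}" "e = {z, (n(x := u)) z}" by blast
    show "e \<in> T'"
    proof (cases "z = x")
      case True
      then have "e = {u, x}" using z by auto
      then show ?thesis using cg(3) by (simp add: T')
    next
      case False
      then show ?thesis using z other[of z] by (auto simp: T' g T)
    qed
  qed
  moreover have "(n(x := u)) z \<in> V \<and> d ((n(x := u)) z) < d z" if "z \<in> V - {u}" for z
    using dec[OF that] u by auto
  ultimately show ?thesis using u by (simp only: rooted_tree_def) blast
qed

lemma exchanges_rooted_tree:
  assumes "exchanges u L T T'" "rooted_tree V u n d T"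
    and "\<And>x. {u, x} \<in> L \<Longrightarrow> x \<in> V - {u}"
  shows "rooted_tree V u (\<lambda>z. if {u, z} \<in> L then u else n z) d T'"
  using assms
proof (induction arbitrary: n rule: exchanges.induct)
  case (exchanges_done T)
  then show ?case by simp
next
  case (exchanges_step x L T T' T'')
  have "rooted_tree V u (n(x := u)) d T'"
    using exchange_rooted_tree exchanges_step by metis
  then have "rooted_tree V u (\<lambda>z. if {u, z} \<in> L - {{u, x}} then u else (n(x := u)) z) d T''"
    using exchanges_step by blast
  moreover have "(\<lambda>z. if {u, z} \<in> L - {{u, x}} then u else (n(x := u)) z)
      = (\<lambda>z. if {u, z} \<in> L then u else n z)"
    using exchanges_step.hyps(1) by (auto simp: fun_eq_iff doubleton_eq_iff)
  ultimately show ?case by simp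
qed

section \<open>The next vertex in terms of parent pointers\<close>

text \<open>
  The value \<open>br z\<close> is the child of the root whose branch contains \<open>z\<close>, in other words the
  last vertex before \<open>u\<close> in the sequence \<open>z, n z, n (n z), \<dots>\<close>.
\<close>

lemma ex_branch:
  assumes rooted: "rooted_tree V u n d T"
  shows "\<exists>br. \<forall>z\<in>V - {u}. br z = (if n z = u then z else br (n z))"
proof (intro exI ballI)
  let ?K = "\<lambda>z. LEAST k. (n ^^ Suc k) z = u"
  fix z assume z: "z \<in> V - {u}"
  have reach: "\<exists>k. (n ^^ k) z = u" if "z \<in> V" for z
    using that
  proof (induction "d z" arbitrary: z rule: less_induct)
    case less
    show ?case
    proof (cases "z = u")
      case True
      then have "(n ^^ 0) z = u" by simp
      then show ?thesis ..
    next
      case False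
      then have "n z \<in> V" "d (n z) < d z"
        using rooted less.prems by (auto simp: rooted_tree_def)
      then obtain k where "(n ^^ k) (n z) = u" using less.hyps by blast
      then have "(n ^^ Suc k) z = u" by (simp add: funpow_swap1)
      then show ?thesis ..
    qed
  qed
  show "(n ^^ ?K z) z = (if n z = u then z else (n ^^ ?K (n z)) (n z))"
  proof (cases "n z = u")
    case True
    then have "?K z = 0" by (intro Least_eq_0) simp
    with True show ?thesis by simp
  next
    case False
    have "n z \<in> V" using z rooted by (auto simp: rooted_tree_def)
    then obtain k where "(n ^^ k) (n z) = u" using reach by blast
    then have "(n ^^ Suc k) z = u" by (simp add: funpow_swap1)
    moreover have "(n ^^ Suc 0) z \<noteq> u" using False by simp
    ultimately have "?K z = Suc (LEAST k. (n ^^ Suc (Suc k)) z = u)"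
      by (rule Least_Suc)
    then have "?K z = Suc (?K (n z))" by (simp add: funpow_swap1)
    with False show ?thesis by (simp add: funpow_swap1)
  qed
qed

text \<open>
  A criterion that avoids computing distances: a walk from a neighbour \<open>w\<close> of \<open>u\<close> to \<open>v\<close>
  that is shorter than the distance from \<open>u\<close> to \<open>v\<close> cannot visit \<open>u\<close>.  So a labelling
  \<open>br\<close> that is constant along all edges not incident to \<open>u\<close> has the same value at \<open>w\<close> and
  \<open>v\<close>, and this value is \<open>w\<close>.
\<close>

lemma next_vertex_eqI:
  assumes connected: "connected_graph V T" and "u \<in> V" "v \<in> V" "u \<noteq> v" and loop: "{u, u} \<notin> T"
    and base: "\<And>w. (u, w) \<in> arcs V T \<Longrightarrow> br w = w"
    and const: "\<And>y z. (y, z) \<in> arcs V T \<Longrightarrow> y \<noteq> u \<Longrightarrow> z \<noteq> u \<Longrightarrow> br y = br z"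
  shows "next_vertex V T u v = br v"
proof -
  have conn: "(u, v) \<in> (arcs V T)\<^sup>*"
    using connected_graph_rtrancl_arcs assms(1-3) .
  define D where "D y z = (LEAST k. (y, z) \<in> arcs V T ^^ k)" for y z
  have D: "graph_dist V T y z = D y z" if "y \<in> V" for y z
    using graph_dist_eq_Least_relpow[OF that] by (simp add: D_def)
  have D_le: "D y z \<le> k" if "(y, z) \<in> arcs V T ^^ k" for y z k
    unfolding D_def using that by (rule Least_le)
  have D_relpow: "(y, z) \<in> arcs V T ^^ D y z" if "(y, z) \<in> (arcs V T)\<^sup>*" for y z
    unfolding D_def using rtrancl_imp_relpow[OF that] by (rule LeastI_ex)
  have D1: "D u w = 1" if "(u, w) \<in> arcs V T" for w
  proof -
    have "D u w \<le> 1" using that by (intro D_le) simp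
    moreover have "D u w \<noteq> 0"
    proof
      assume "D u w = 0"
      then have "u = w" using D_relpow[of u w] that by auto
      then show False using that loop by (simp add: arcs_def)
    qed
    ultimately show ?thesis by linarith
  qed
  have "D u v \<noteq> 0" using D_relpow[OF conn] \<open>u \<noteq> v\<close> by (metis relpow_0_E)
  then obtain k where k: "D u v = Suc k" by (cases "D u v") auto
  have stays: "br y = br v" if "(y, v) \<in> arcs V T ^^ j" "y \<noteq> u" "j \<le> k" for y j
    using that
  proof (induction j arbitrary: y)
    case (Suc j)
    then obtain y' where y': "(y, y') \<in> arcs V T" "(y', v) \<in> arcs V T ^^ j"
      by (meson relpow_Suc_E2)
    have "y' \<noteq> u" using D_le[of u v j] y'(2) k Suc.prems(3) by auto
    then show ?case using Suc y' const by (metis Suc_leD)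
  qed simp
  have uniq: "w = br v" if "w \<in> V" "graph_dist V T u w = 1"
      "graph_dist V T w v = graph_dist V T u v - 1" for w
  proof -
    have Duw: "D u w = 1" and Dwv: "D w v = k"
      using that D \<open>u \<in> V\<close> k by auto
    have "(u, w) \<in> arcs V T ^^ D u w"
      using D_relpow connected_graph_rtrancl_arcs[OF connected \<open>u \<in> V\<close> that(1)] .
    then have uw: "(u, w) \<in> arcs V T" using Duw by simp
    then have "w \<noteq> u" using loop by (auto simp: arcs_def)
    have "(w, v) \<in> (arcs V T)\<^sup>*"
      using uw conn rtrancl_arcs_sym by (meson r_into_rtrancl rtrancl_trans)
    then have "br w = br v" using D_relpow Dwv stays \<open>w \<noteq> u\<close> by blast
    with base[OF uw] show ?thesis by simp
  qed
  obtain w where w: "(u, w) \<in> arcs V T" "(w, v) \<in> arcs V T ^^ k"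
    using D_relpow[OF conn] k by (metis relpow_Suc_E2)
  then have wV: "w \<in> V" by (auto simp: arcs_def)
  have "D w v = k"
  proof (rule antisym)
    show "D w v \<le> k" using D_le w(2) .
    have "(w, v) \<in> arcs V T ^^ D w v" using D_relpow w(2) relpow_imp_rtrancl by metis
    then have "(u, v) \<in> arcs V T ^^ Suc (D w v)" using w(1) by (meson relpow_Suc_I2)
    from D_le[OF this] show "k \<le> D w v" using k by simp
  qed
  then have "graph_dist V T u w = 1" "graph_dist V T w v = graph_dist V T u v - 1"
    using D1[OF w(1)] D \<open>u \<in> V\<close> wV k by auto
  with wV uniq show ?thesis
    unfolding next_vertex_def by (intro the_equality) metis+
qed


lemma rooted_tree_connected:
  assumes "rooted_tree V u n d T"
  shows "connected_graph V T"
  unfolding connected_graph_def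
proof (intro conjI ballI)
  show "V \<noteq> {}" using assms by (auto simp: rooted_tree_def)
  fix y z assume "y \<in> V" "z \<in> V"
  then have "(y, z) \<in> (arcs V T)\<^sup>*"
    using rooted_tree_rtrancl_root[OF assms] rtrancl_arcs_sym rtrancl_trans by metis
  then show "\<exists>p. walk V T y p z" using ex_distinct_walk \<open>y \<in> V\<close> by metis
qed

lemma next_vertex_rooted_tree:
  assumes rooted: "rooted_tree V u n d T" and z: "z \<in> V - {u}"
  shows "next_vertex V T u z = (if n z = u then z else next_vertex V T u (n z))"
proof -
  obtain br where br: "\<And>z. z \<in> V - {u} \<Longrightarrow> br z = (if n z = u then z else br (n z))"
    using ex_branch[OF rooted] by metis
  have u: "u \<in> V" and nV: "n z \<in> V" using rooted z by (auto simp: rooted_tree_def)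
  have "next_vertex V T u v = br v" if "v \<in> V - {u}" for v
  proof (rule next_vertex_eqI)
    show "connected_graph V T" by (rule rooted_tree_connected[OF rooted])
    show "{u, u} \<notin> T" using rooted_tree_edgeE[OF rooted, of u u] by auto
  next
    fix w assume "(u, w) \<in> arcs V T"
    then have "w \<in> V - {u}" "n w = u"
      using rooted by (auto simp: arcs_def elim: rooted_tree_edgeE)
    then show "br w = w" using br by simp
  next
    fix y z assume "(y, z) \<in> arcs V T" "y \<noteq> u" "z \<noteq> u"
    then show "br y = br z"
      using br[of y] br[of z] rooted by (auto simp: arcs_def elim!: rooted_tree_edgeE)
  qed (use u that in auto)
  then show ?thesis using br[OF z] z nV by auto
qed

text \<open>
  The recursion computes the first neighbour of \<open>u\<close> on the way from \<open>z\<close> up to the root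
  \<open>u\<close> of \<open>T0\<close>.  It covers the vertex \<open>r\<close> too, where no exchange takes place: all edges at
  \<open>r\<close> belong to \<open>T0\<close>, so that every neighbour of \<open>r\<close> has \<open>r\<close> as its parent.
\<close>

lemma algorithm_output_recursion:
  assumes simple: "simple_graph V E" and r: "r \<in> V" and T0: "vertex_spanning_tree V E r T0"
    and alg: "algorithm_output V E r T0 f" and u: "u \<in> V"
    and rooted: "rooted_tree V u n d T0" and z: "z \<in> V - {u}"
  shows "f u z = (if {u, z} \<in> E then z else f u (n z))"
proof -
  obtain T where T: "T r = T0"
    "\<And>u. u \<in> V - {r} \<Longrightarrow> exchanges u ((E - T0) \<inter> incident_edges E u) T0 (T u)"
    "\<And>u v. u \<in> V \<Longrightarrow> v \<in> V - {u} \<Longrightarrow> f u v = next_vertex V (T u) u v"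
    using alg unfolding algorithm_output_def by blast
  have sub: "T0 \<subseteq> E" "incident_edges E r \<subseteq> T0"
    using T0 by (auto simp: vertex_spanning_tree_def spanning_tree_def)
  have nbr: "x \<in> V - {u}" if "{u, x} \<in> E" for x
    using simple that by (fastforce simp: simple_graph_def doubleton_eq_iff)
  have n_root: "n x = u" if "{u, x} \<in> T0" for x
    using rooted that by (auto elim: rooted_tree_edgeE)
  let ?n = "\<lambda>x. if {u, x} \<in> E then u else n x"
  have rooted': "rooted_tree V u ?n d (T u)"
  proof (cases "u = r")
    case True
    then have "?n = n" using sub n_root by (auto simp: fun_eq_iff incident_edges_def)
    with True T(1) rooted show ?thesis by simp
  next
    case False
    then have "rooted_tree V u
        (\<lambda>x. if {u, x} \<in> (E - T0) \<inter> incident_edges E u then u else n x) d (T u)"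
      using exchanges_rooted_tree[OF T(2) rooted] u nbr by auto
    moreover have "(\<lambda>x. if {u, x} \<in> (E - T0) \<inter> incident_edges E u then u else n x) = ?n"
      using n_root by (auto simp: fun_eq_iff incident_edges_def)
    ultimately show ?thesis by simp
  qed
  have "n z \<in> V" using rooted z by (auto simp: rooted_tree_def)
  have "n z \<noteq> u" if "{u, z} \<notin> E"
  proof
    assume "n z = u"
    then have "{z, u} \<in> T0" using rooted z by (auto simp: rooted_tree_def)
    then show False using that sub by (auto simp: insert_commute)
  qed
  then show ?thesis
    using next_vertex_rooted_tree[OF rooted' z] T(3)[OF u] z \<open>n z \<in> V\<close> by auto
qed

section \<open>First neighbours and connected sets of tree vertices\<close>

text \<open>
  Only the edge from \<open>v\<close> to \<open>n v\<close> leads out of the set of descendants of \<open>v\<close>, so a path in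
  \<open>S\<close> that avoids \<open>n v\<close> never leaves this set; but the root \<open>w\<close> is outside of it.
\<close>

lemma parent_in_connected_set:
  assumes rooted: "rooted_tree V w n d T" and SV: "S \<subseteq> V" and "v \<in> S" "v \<noteq> w"
    and path: "(v, w) \<in> (arcs S T)\<^sup>*"
  shows "n v \<in> S"
proof (rule ccontr)
  assume out: "n v \<notin> S"
  let ?P = "{(z, n z) | z. z \<in> V - {w}}"
  \<comment> \<open>\<open>(z, v) \<in> ?P\<^sup>*\<close> means that \<open>z\<close> is a descendant of \<open>v\<close>\<close>
  have "(z, v) \<in> ?P\<^sup>*" if "(v, z) \<in> (arcs S T)\<^sup>*" for z
    using that
  proof (induction rule: rtrancl_induct)
    case (step y z)
    then have yz: "y \<in> S" "z \<in> S" "{y, z} \<in> T" by (auto simp: arcs_def)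
    show ?case
    proof (rule rooted_tree_edgeE[OF rooted yz(3)])
      assume y: "y \<in> V - {w}" "z = n y"
      then have "y \<noteq> v" using out yz by auto
      with step.IH obtain y' where "(y, y') \<in> ?P" "(y', v) \<in> ?P\<^sup>*"
        by (meson converse_rtranclE)
      with y show ?thesis by auto
    next
      assume "z \<in> V - {w}" "y = n z"
      then have "(z, y) \<in> ?P" by blast
      with step.IH show ?thesis by (meson converse_rtrancl_into_rtrancl)
    qed
  qed simp
  from this[OF path] show False
    using \<open>v \<noteq> w\<close> by (auto elim: converse_rtranclE)
qed

text \<open>
  The climb from \<open>v\<close> towards \<open>w\<close> stays in \<open>S\<close> and stops at the latest at a child of
  \<open>w\<close>, because \<open>T \<subseteq> E\<close>.
\<close>

lemma step_in_connected_set: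
  assumes rooted: "rooted_tree V w n d T" and TE: "T \<subseteq> E"
    and step: "\<And>z. z \<in> V - {w} \<Longrightarrow> g z = (if {w, z} \<in> E then z else g (n z))"
    and SV: "S \<subseteq> V" and "v \<in> S" "v \<noteq> w" "(v, w) \<in> (arcs S T)\<^sup>*"
  shows "g v \<in> S"
  using assms(5-7)
proof (induction "d v" arbitrary: v rule: less_induct)
  case less
  then have v: "v \<in> V - {w}" using SV by auto
  then have edge: "{v, n v} \<in> T" and dec: "d (n v) < d v"
    using rooted by (auto simp: rooted_tree_def)
  show ?case
  proof (cases "{w, v} \<in> E")
    case True
    then show ?thesis using step[OF v] less.prems by simp
  next
    case False
    then have "n v \<noteq> w" using edge TE by (auto simp: insert_commute)
    moreover have nS: "n v \<in> S"
      using parent_in_connected_set[OF rooted SV less.prems] .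
    moreover have "(n v, v) \<in> arcs S T"
      using edge nS less.prems(1) by (simp add: arcs_def insert_commute)
    then have "(n v, w) \<in> (arcs S T)\<^sup>*"
      using less.prems(3) by (rule converse_rtrancl_into_rtrancl)
    ultimately have "g (n v) \<in> S" using less.hyps dec by blast
    then show ?thesis using step[OF v] False by simp
  qed
qed

text \<open>
  All vertices visited on the climb from \<open>z\<close> to its first neighbour \<open>g z\<close> of \<open>u\<close> have the
  same first neighbour, so the climb takes place inside the fibre of \<open>z\<close>.
\<close>

lemma first_neighbour_fibre:
  assumes rooted: "rooted_tree V u n d T" and TE: "T \<subseteq> E"
    and step: "\<And>z. z \<in> V - {u} \<Longrightarrow> g z = (if {u, z} \<in> E then z else g (n z))"
    and z: "z \<in> V - {u}"
  shows "{u, g z} \<in> E \<and> g z \<in> V - {u} \<and>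
    (z, g z) \<in> (arcs {y \<in> V - {u}. g y = g z} T)\<^sup>*"
  using z
proof (induction "d z" arbitrary: z rule: less_induct)
  case less
  then have edge: "{z, n z} \<in> T" and dec: "d (n z) < d z" and nV: "n z \<in> V"
    using rooted by (auto simp: rooted_tree_def)
  show ?case
  proof (cases "{u, z} \<in> E")
    case True
    then show ?thesis using step less.prems by simp
  next
    case False
    then have nz: "n z \<in> V - {u}" using edge TE nV by (auto simp: insert_commute)
    have eq: "g z = g (n z)" using False step less.prems by simp
    have "(z, n z) \<in> arcs {y \<in> V - {u}. g y = g z} T"
      using less.prems nz eq edge by (auto simp: arcs_def)
    with less.hyps[OF dec nz] show ?thesis
      unfolding eq by (blast intro: converse_rtrancl_into_rtrancl)
  qed
qed

section \<open>The algorithm yields a smooth travel groupoid\<close>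

theorem theorem3p5:
  fixes V :: "'a set" and E T0 :: "'a set set" and r :: 'a and f :: "'a \<Rightarrow> 'a \<Rightarrow> 'a"
  assumes "finite V" and "simple_graph V E" and "connected_graph V E"
    and "r \<in> V" and "vertex_spanning_tree V E r T0"
    and "algorithm_output V E r T0 f"
  shows "travel_groupoid_on V E f \<and> smooth_travel_groupoid V f"
proof -
  have TE: "T0 \<subseteq> E" and tree: "is_tree V T0"
    using assms(5) by (auto simp: vertex_spanning_tree_def spanning_tree_def)
  obtain n d where rooted: "\<And>u. u \<in> V \<Longrightarrow> rooted_tree V u (n u) (d u) T0"
    using tree_rooted_anywhere[OF tree] by metis
  have step: "f u z = (if {u, z} \<in> E then z else f u (n u z))" if "u \<in> V" "z \<in> V - {u}" for u z
    using algorithm_output_recursion assms(2,4-6) that(1) rooted[OF that(1)] that(2) .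
  have self: "f u u = u" if "u \<in> V" for u
    using assms(6) that by (auto simp: algorithm_output_def)
  define S where "S u x = {z \<in> V - {u}. f u z = x}" for u x
  have fibre: "{u, f u z} \<in> E" "f u z \<in> V - {u}" "(z, f u z) \<in> (arcs (S u (f u z)) T0)\<^sup>*"
    if "u \<in> V" "z \<in> V - {u}" for u z
    using first_neighbour_fibre[OF rooted[OF that(1)] TE step[OF that(1)] that(2)]
    by (auto simp: S_def)
  have fV: "f u v \<in> V" if "u \<in> V" "v \<in> V" for u v
    using fibre(2)[of u v] self that by (cases "v = u") auto
  have nbr: "f u v = v" if "{u, v} \<in> E" "u \<in> V" "v \<in> V - {u}" for u v
    using step that by simp
  \<comment> \<open>both (t2) and smoothness are instances of this closure property of the fibres\<close>
  have closed: "f w v \<in> S u x" if "u \<in> V" "v \<in> S u x" "w \<in> S u x" for u v w x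
  proof (cases "v = w")
    case True
    then show ?thesis using self that by (auto simp: S_def)
  next
    case False
    have "z \<in> V - {u} \<and> f u z = x" if "z \<in> S u x" for z using that by (simp add: S_def)
    then have "(v, x) \<in> (arcs (S u x) T0)\<^sup>*" "(w, x) \<in> (arcs (S u x) T0)\<^sup>*"
      using fibre(3)[OF that(1)] that(2,3) by metis+
    then have path: "(v, w) \<in> (arcs (S u x) T0)\<^sup>*"
      using rtrancl_arcs_sym rtrancl_trans by metis
    have wV: "w \<in> V" and sub: "S u x \<subseteq> V" using that by (auto simp: S_def)
    show ?thesis
      using step_in_connected_set[OF rooted[OF wV] TE step[OF wV] sub that(2) False path] .
  qed
  have t1: "f (f u v) u = u" if "u \<in> V" "v \<in> V" for u v
  proof (cases "v = u")
    case True
    then show ?thesis using self that by simp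
  next
    case False
    then show ?thesis
      using fibre(1,2)[of u v] that by (intro nbr) (auto simp: insert_commute)
  qed
  have t2: "u = v" if "u \<in> V" "v \<in> V" "f (f u v) v = u" for u v
  proof (rule ccontr)
    assume "u \<noteq> v"
    then have "v \<in> S u (f u v)" "f u v \<in> S u (f u v)"
      using fibre(1,2)[of u v] nbr[of u "f u v"] that by (auto simp: S_def)
    then have "f (f u v) v \<in> S u (f u v)" using closed that(1) by blast
    with that(3) show False by (auto simp: S_def)
  qed
  have t4: "f u (f w v) = f u v" if "u \<in> V" "v \<in> V" "w \<in> V" "f u v = f u w" for u v w
  proof (cases "u = v \<or> u = w")
    case True
    moreover have "f u z \<noteq> u" if "z \<in> V" "z \<noteq> u" for z
      using fibre(2)[of u z] \<open>u \<in> V\<close> that by simp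
    ultimately have "v = u" "w = u" using self[OF that(1)] that(2-4) by metis+
    then show ?thesis using self[OF that(1)] by simp
  next
    case False
    then have "v \<in> S u (f u v)" "w \<in> S u (f u v)" using that by (auto simp: S_def)
    then show ?thesis using closed that(1) by (auto simp: S_def)
  qed
  have "E = {{u, v} | u v. u \<in> V \<and> v \<in> V \<and> u \<noteq> f u v \<and> f u v = v}"
  proof (intro set_eqI iffI)
    fix e assume "e \<in> E"
    then obtain u v where "u \<in> V" "v \<in> V" "u \<noteq> v" "e = {u, v}"
      using assms(2) by (auto simp: simple_graph_def)
    moreover from this have "f u v = v" using nbr \<open>e \<in> E\<close> by simp
    ultimately show "e \<in> {{u, v} | u v. u \<in> V \<and> v \<in> V \<and> u \<noteq> f u v \<and> f u v = v}"
      by (metis (mono_tags, lifting) mem_Collect_eq)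
  next
    fix e assume "e \<in> {{u, v} | u v. u \<in> V \<and> v \<in> V \<and> u \<noteq> f u v \<and> f u v = v}"
    then obtain u v where "u \<in> V" "v \<in> V" "u \<noteq> f u v" "f u v = v" "e = {u, v}" by blast
    then show "e \<in> E" using fibre(1)[of u v] by auto
  qed
  moreover have "travel_groupoid V f"
    using t1 t2 fV assms(4) by (auto simp: travel_groupoid_def groupoid_def)
  ultimately show ?thesis
    using t4 by (simp add: travel_groupoid_on_def smooth_travel_groupoid_def)
qed

end
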